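(* Let $b$ and $b'$ be elements of an $\omega$-complete effect monoid $M$, and let $S\subseteq M$ be any (potentially uncountable or non-directed) non-empty subset. (1) If $\bigvee S$ exists, then so does $\bigvee_{s\in S} b\cdot s\cdot b'$, and $b\cdot(\bigvee S)\cdot b'=\bigvee_{s\in S} b\cdot s\cdot b'$. (2) If $\bigwedge S$ exists, then so does $\bigwedge_{s\in S} b\cdot s\cdot b'$, and $b\cdot(\bigwedge S)\cdot b'=\bigwedge_{s\in S} b\cdot s\cdot b'$.
   Context: An effect algebra is a set $E$ with an element $0$, a partial binary operation $a+b$ (the partial sum), and a total complement $a\mapsto a^\perp$, such that: the sum is commutative and associative wherever defined, $a+0=a$, $a^\perp$ is the unique element with $a+a^\perp=1$ where $1:=0^\perp$, and $a+1$ defined implies $a=0$. The order is $a\le b$ iff $b=a+c$ for some $c$. An effect monoid is an effect algebra with an associative total multiplication $\cdot$ with unit $1$ which distributes over the partial sum on both sides. It is $\omega$-complete if every increasing sequence has a supremum. *)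

theory Defs
  imports "HOL-Algebra.Lattice"
begin

text \<open>The partial sum is option-valued: \<^term>\<open>None\<close> means that the sum is undefined.\<close>

record 'a effect_algebra = "'a partial_object" +
  psum :: "'a \<Rightarrow> 'a \<Rightarrow> 'a option"
  ezero :: 'a
  ecompl :: "'a \<Rightarrow> 'a"

record 'a effect_monoid = "'a effect_algebra" +
  emult :: "'a \<Rightarrow> 'a \<Rightarrow> 'a" (infixl "\<cdot>\<index>" 70)

definition eone :: "('a, 'b) effect_algebra_scheme \<Rightarrow> 'a" where
  "eone E = ecompl E (ezero E)"

definition eorder :: "('a, 'b) effect_algebra_scheme \<Rightarrow> 'a gorder" where
  "eorder E =
    \<lparr>carrier = carrier E, eq = (=), le = (\<lambda>a b. \<exists>c\<in>carrier E. psum E a c = Some b)\<rparr>"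

locale effect_algebra =
  fixes E :: "('a, 'b) effect_algebra_scheme" (structure)
  assumes zero_closed: "ezero E \<in> carrier E"
    and compl_closed: "a \<in> carrier E \<Longrightarrow> ecompl E a \<in> carrier E"
    and psum_closed:
      "\<lbrakk>a \<in> carrier E; b \<in> carrier E; psum E a b = Some c\<rbrakk> \<Longrightarrow> c \<in> carrier E"
    and psum_commute:
      "\<lbrakk>a \<in> carrier E; b \<in> carrier E\<rbrakk> \<Longrightarrow> psum E a b = psum E b a"
    \<comment> \<open>If \<open>(a + b) + c\<close> is defined, then so is \<open>a + (b + c)\<close> and the two are equal;
      the converse direction follows by commutativity.\<close>
    and psum_assoc:
      "\<lbrakk>a \<in> carrier E; b \<in> carrier E; c \<in> carrier E; psum E a b = Some d; psum E d c = Some e\<rbrakk>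
        \<Longrightarrow> \<exists>f. psum E b c = Some f \<and> psum E a f = Some e"
    and psum_zero: "a \<in> carrier E \<Longrightarrow> psum E a (ezero E) = Some a"
    and psum_compl: "a \<in> carrier E \<Longrightarrow> psum E a (ecompl E a) = Some (eone E)"
    and compl_unique:
      "\<lbrakk>a \<in> carrier E; b \<in> carrier E; psum E a b = Some (eone E)\<rbrakk> \<Longrightarrow> b = ecompl E a"
    and psum_one: "\<lbrakk>a \<in> carrier E; psum E a (eone E) \<noteq> None\<rbrakk> \<Longrightarrow> a = ezero E"

locale effect_monoid = effect_algebra M for M :: "('a, 'b) effect_monoid_scheme" (structure) +
  assumes mult_closed: "\<lbrakk>a \<in> carrier M; b \<in> carrier M\<rbrakk> \<Longrightarrow> a \<cdot> b \<in> carrier M"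
    and mult_assoc:
      "\<lbrakk>a \<in> carrier M; b \<in> carrier M; c \<in> carrier M\<rbrakk> \<Longrightarrow> (a \<cdot> b) \<cdot> c = a \<cdot> (b \<cdot> c)"
    and one_mult: "a \<in> carrier M \<Longrightarrow> eone M \<cdot> a = a"
    and mult_one: "a \<in> carrier M \<Longrightarrow> a \<cdot> eone M = a"
    and mult_psum_distrib:
      "\<lbrakk>a \<in> carrier M; b \<in> carrier M; c \<in> carrier M; psum M b c = Some d\<rbrakk>
        \<Longrightarrow> psum M (a \<cdot> b) (a \<cdot> c) = Some (a \<cdot> d)"
    and psum_mult_distrib:
      "\<lbrakk>a \<in> carrier M; b \<in> carrier M; c \<in> carrier M; psum M a b = Some d\<rbrakk>
        \<Longrightarrow> psum M (a \<cdot> c) (b \<cdot> c) = Some (d \<cdot> c)"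

locale omega_complete_effect_monoid = effect_monoid +
  assumes omega_complete:
    "\<lbrakk>\<And>n::nat. a n \<in> carrier M; \<And>n. le (eorder M) (a n) (a (Suc n))\<rbrakk>
      \<Longrightarrow> \<exists>x. is_lub (eorder M) x (range a)"

text \<open>In particular, suprema and infima with respect to \<^const>\<open>eorder\<close> are unique.\<close>

lemma (in effect_algebra) partial_order_eorder: "partial_order (eorder E)"
proof
  have one: "eone E \<in> carrier E"
    by (simp add: eone_def zero_closed compl_closed)
  have cancel: "x = ezero E"
    if a: "a \<in> carrier E" and x: "x \<in> carrier E" and s: "psum E a x = Some a" for a x
  proof -
    have "psum E x a = Some a"
      using psum_commute[OF a x] s by simp
    then obtain f where "psum E a (ecompl E a) = Some f" "psum E x f = Some (eone E)"
      using psum_assoc[OF x a compl_closed[OF a] _ psum_compl[OF a]] by blast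
    then have "psum E x (eone E) \<noteq> None"
      using psum_compl[OF a] by simp
    then show ?thesis
      using psum_one x by blast
  qed
  have pos: "d = ezero E"
    if c: "c \<in> carrier E" and d: "d \<in> carrier E" and s: "psum E c d = Some (ezero E)" for c d
  proof -
    have "psum E (ezero E) (eone E) = Some (eone E)"
      using psum_compl[OF zero_closed] by (simp add: eone_def)
    then have "psum E d (eone E) \<noteq> None"
      using psum_assoc[OF c d one s] by auto
    then show ?thesis
      using psum_one d by blast
  qed
  show "x \<sqsubseteq>\<^bsub>eorder E\<^esub> x" if "x \<in> carrier (eorder E)" for x
    using that psum_zero zero_closed by (auto simp: eorder_def)
  show "x .=\<^bsub>eorder E\<^esub> y"
    if "x \<sqsubseteq>\<^bsub>eorder E\<^esub> y" "y \<sqsubseteq>\<^bsub>eorder E\<^esub> x" "x \<in> carrier (eorder E)" "y \<in> carrier (eorder E)" for x y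
  proof -
    from that obtain c d where c: "c \<in> carrier E" "psum E x c = Some y"
      and d: "d \<in> carrier E" "psum E y d = Some x"
      and x: "x \<in> carrier E" and y: "y \<in> carrier E"
      by (auto simp: eorder_def)
    obtain f where f: "psum E c d = Some f" "psum E x f = Some x"
      using psum_assoc[OF x c(1) d(1) c(2) d(2)] by blast
    have "f = ezero E"
      using cancel[OF x psum_closed[OF c(1) d(1) f(1)] f(2)] .
    then have "d = ezero E"
      using pos[OF c(1) d(1)] f(1) by simp
    then show ?thesis
      using d(2) psum_zero[OF y] by (simp add: eorder_def)
  qed
  show "x \<sqsubseteq>\<^bsub>eorder E\<^esub> z"
    if "x \<sqsubseteq>\<^bsub>eorder E\<^esub> y" "y \<sqsubseteq>\<^bsub>eorder E\<^esub> z" "x \<in> carrier (eorder E)" for x y z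
  proof -
    from that obtain c d where c: "c \<in> carrier E" "psum E x c = Some y"
      and d: "d \<in> carrier E" "psum E y d = Some z" and x: "x \<in> carrier E"
      by (auto simp: eorder_def)
    then obtain f where "psum E c d = Some f" "psum E x f = Some z"
      using psum_assoc[OF x c(1) d(1) c(2) d(2)] by blast
    then show ?thesis
      using psum_closed[OF c(1) d(1)] by (auto simp: eorder_def)
  qed
qed (auto simp: eorder_def)

end

theory Submission
  imports Defs
begin

text \<open>Multiplication by \<open>b\<close> is inverted approximately: for \<open>u \<le> b\<close>, the partial sums \<open>x\<^sub>n\<close> of
  \<open>\<Sum>n. (1 - b)\<^sup>n \<cdot> u\<close> satisfy \<open>u = b \<cdot> x\<^sub>n + (1 - b)\<^sup>n \<cdot> u\<close>, and \<open>u \<le> b \<cdot> s\<close> implies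
  \<open>x\<^sub>n \<le> s\<close>. By an Archimedean argument the remainders \<open>(1 - b)\<^sup>n \<cdot> u\<close> have infimum \<open>0\<close>, so a lower
  bound \<open>u\<close> of \<open>b \<cdot> S\<close> satisfies \<open>u \<le> b \<cdot> \<Sqinter>S\<close>. Suprema follow by complementation in the interval
  from \<open>0\<close> to \<open>b\<close>; upper bounds of \<open>b \<cdot> S\<close> can be moved into this interval because binary meets
  exist. Right multiplication is left multiplication in the opposite monoid.\<close>

section \<open>Partial sums, order and complements in an effect algebra\<close>

context effect_algebra
begin

text \<open>Carrier membership is built into the relation, so commutativity and associativity need
  no separate closure conditions.\<close>

definition sums :: "'a \<Rightarrow> 'a \<Rightarrow> 'a \<Rightarrow> bool" where
  "sums a b c \<longleftrightarrow> a \<in> carrier E \<and> b \<in> carrier E \<and> psum E a b = Some c"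

definition leq :: "'a \<Rightarrow> 'a \<Rightarrow> bool" where
  "leq a b \<longleftrightarrow> (\<exists>c. sums a c b)"

lemma sumsD: "sums a b c \<Longrightarrow> a \<in> carrier E" "sums a b c \<Longrightarrow> b \<in> carrier E"
  "sums a b c \<Longrightarrow> c \<in> carrier E"
  using psum_closed by (auto simp: sums_def)

lemma leqD: "leq a b \<Longrightarrow> a \<in> carrier E" "leq a b \<Longrightarrow> b \<in> carrier E"
  using sumsD by (auto simp: leq_def)

lemma one_closed: "eone E \<in> carrier E"
  by (simp add: eone_def zero_closed compl_closed)

lemma sums_commute: "sums a b c \<Longrightarrow> sums b a c"
  using psum_commute by (auto simp: sums_def)

lemma sums_unique: "sums a b c \<Longrightarrow> sums a b d \<Longrightarrow> c = d"
  by (auto simp: sums_def)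

lemma sums_assoc:
  assumes "sums a b d" "sums d c e"
  obtains f where "sums b c f" "sums a f e"
  using psum_assoc[of a b c d e] psum_closed assms unfolding sums_def by metis

lemma sums_assoc':
  assumes "sums b c f" "sums a f e"
  obtains d where "sums a b d" "sums d c e"
  by (meson assms sums_assoc sums_commute)

lemma sums_zero: "a \<in> carrier E \<Longrightarrow> sums a (ezero E) a"
  by (simp add: sums_def psum_zero zero_closed)

lemma sums_compl: "a \<in> carrier E \<Longrightarrow> sums a (ecompl E a) (eone E)"
  by (simp add: sums_def psum_compl compl_closed)

lemma compl_eqI: "sums a b (eone E) \<Longrightarrow> b = ecompl E a"
  using compl_unique by (auto simp: sums_def)

lemma compl_compl: "a \<in> carrier E \<Longrightarrow> ecompl E (ecompl E a) = a"
  using compl_eqI sums_commute sums_compl by metis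

text \<open>Reassociating \<open>(a + b) + (1 - c) = 1\<close> gives
  \<open>a + (b + (1 - c)) = 1\<close>, and uniqueness of complements identifies the inner
  sum.\<close>

lemma sums_shift_compl:
  assumes "sums a b c"
  shows "sums (ecompl E c) b (ecompl E a)"
proof -
  obtain f where f: "sums b (ecompl E c) f" "sums a f (eone E)"
    using sums_assoc[OF assms sums_compl[OF sumsD(3)[OF assms]]] by blast
  then show ?thesis
    using compl_eqI sums_commute by metis
qed

text \<open>Both \<open>1 - b\<close> and \<open>1 - b'\<close> equal \<open>(1 - c) + a\<close>,
  and complementation is an involution.\<close>

lemma sums_cancel:
  assumes "sums a b c" "sums a b' c"
  shows "b = b'"
proof -
  have "ecompl E b = ecompl E b'"
    using sums_shift_compl[OF sums_commute[OF assms(1)]]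
      sums_shift_compl[OF sums_commute[OF assms(2)]] sums_unique by blast
  then show ?thesis
    using compl_compl sumsD assms by metis
qed

lemma leq_refl: "a \<in> carrier E \<Longrightarrow> leq a a"
  using sums_zero by (auto simp: leq_def)

lemma leq_trans: "leq a b \<Longrightarrow> leq b c \<Longrightarrow> leq a c"
  unfolding leq_def by (meson sums_assoc)

lemma le_eorder: "a \<in> carrier E \<Longrightarrow> le (eorder E) a b \<longleftrightarrow> leq a b"
  by (auto simp: leq_def sums_def eorder_def)

lemma leq_antisym: "leq a b \<Longrightarrow> leq b a \<Longrightarrow> a = b"
  using partial_order.le_antisym[OF partial_order_eorder, of a b] le_eorder leqD
  by (auto simp: eorder_def)

lemma sums_leq: "sums a b c \<Longrightarrow> leq a c" "sums a b c \<Longrightarrow> leq b c"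
  using sums_commute by (auto simp: leq_def)

lemma leq_one: "a \<in> carrier E \<Longrightarrow> leq a (eone E)"
  using sums_compl sums_leq by blast

lemma zero_leq: "a \<in> carrier E \<Longrightarrow> leq (ezero E) a"
  using sums_zero sums_leq by blast

lemma leq_zero: "leq a (ezero E) \<Longrightarrow> a = ezero E"
  using leq_antisym zero_leq leqD by blast

lemma compl_antimono: "leq a b \<Longrightarrow> leq (ecompl E b) (ecompl E a)"
  using sums_shift_compl by (auto simp: leq_def)

lemma sums_mono_left:
  assumes "leq a a'" "sums a' b c'"
  obtains c where "sums a b c" "leq c c'"
proof -
  obtain t where t: "sums t a a'"
    using assms(1) sums_commute by (auto simp: leq_def)
  show ?thesis
    using sums_assoc[OF t assms(2)] sums_leq that by metis
qed

lemma sums_mono: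
  assumes "leq a a'" "leq b b'" "sums a' b' c'"
  obtains c where "sums a b c" "leq c c'"
proof -
  obtain d where d: "sums a b' d" "leq d c'"
    using sums_mono_left assms by metis
  obtain c where "sums b a c" "leq c d"
    using sums_mono_left assms(2) sums_commute[OF d(1)] by metis
  then show ?thesis
    using that d(2) leq_trans sums_commute by metis
qed

lemma leq_cancel:
  assumes "sums a b c" "sums a b' c'" "leq c c'"
  shows "leq b b'"
proof -
  obtain t where t: "sums c t c'"
    using assms(3) by (auto simp: leq_def)
  show ?thesis
    using sums_assoc[OF assms(1) t] sums_cancel assms(2) sums_leq by metis
qed

text \<open>Writing \<open>a' = a + t\<close>, cancellation of \<open>a\<close> gives
  \<open>b = t + b'\<close>.\<close>

lemma leq_diff:
  assumes "sums a b u" "sums a' b' u" "leq a a'"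
  shows "leq b' b"
proof -
  obtain t where t: "sums a t a'"
    using assms(3) by (auto simp: leq_def)
  show ?thesis
    using sums_assoc[OF t assms(2)] sums_cancel assms(1) sums_leq by metis
qed

lemma is_lub_iff:
  assumes "A \<subseteq> carrier E"
  shows "is_lub (eorder E) x A \<longleftrightarrow>
    x \<in> carrier E \<and> (\<forall>s\<in>A. leq s x) \<and> (\<forall>u. (\<forall>s\<in>A. leq s u) \<and> u \<in> carrier E \<longrightarrow> leq x u)"
proof -
  have "carrier (eorder E) = carrier E"
    by (simp add: eorder_def)
  moreover from this have "Upper (eorder E) A = {u \<in> carrier E. \<forall>s\<in>A. leq s u}"
    using assms by (auto simp: Upper_def le_eorder subset_iff)
  ultimately show ?thesis
    by (auto simp: least_def le_eorder)
qed

lemma is_glb_iff: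
  assumes "A \<subseteq> carrier E"
  shows "is_glb (eorder E) x A \<longleftrightarrow>
    x \<in> carrier E \<and> (\<forall>s\<in>A. leq x s) \<and> (\<forall>u. (\<forall>s\<in>A. leq u s) \<and> u \<in> carrier E \<longrightarrow> leq u x)"
proof -
  have "carrier (eorder E) = carrier E"
    by (simp add: eorder_def)
  moreover from this have "Lower (eorder E) A = {u \<in> carrier E. \<forall>s\<in>A. leq u s}"
    using assms by (auto simp: Lower_def le_eorder subset_iff)
  ultimately show ?thesis
    by (auto simp: greatest_def le_eorder)
qed

text \<open>\<open>sup\<close> is defined by choice; antisymmetry leaves only one candidate.\<close>

lemma sup_eqI:
  assumes "is_lub (eorder E) x A" "A \<subseteq> carrier E"
  shows "\<Squnion>\<^bsub>eorder E\<^esub> A = x"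
  unfolding sup_def
  by (rule some_equality) (use assms in \<open>auto simp: is_lub_iff intro: leq_antisym\<close>)

lemma inf_eqI:
  assumes "is_glb (eorder E) x A" "A \<subseteq> carrier E"
  shows "\<Sqinter>\<^bsub>eorder E\<^esub> A = x"
  unfolding inf_def
  by (rule some_equality) (use assms in \<open>auto simp: is_glb_iff intro: leq_antisym\<close>)

end

section \<open>Multiplication and powers in an effect monoid\<close>

context effect_monoid
begin

lemma sums_mult_left: "a \<in> carrier M \<Longrightarrow> sums b c d \<Longrightarrow> sums (a \<cdot> b) (a \<cdot> c) (a \<cdot> d)"
  using mult_psum_distrib mult_closed by (auto simp: sums_def)

lemma sums_mult_right: "a \<in> carrier M \<Longrightarrow> sums b c d \<Longrightarrow> sums (b \<cdot> a) (c \<cdot> a) (d \<cdot> a)"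
  using psum_mult_distrib mult_closed by (auto simp: sums_def)

lemma sums_split_left:
  "a \<in> carrier M \<Longrightarrow> b \<in> carrier M \<Longrightarrow> sums (b \<cdot> a) (ecompl M b \<cdot> a) a"
  using sums_mult_right[OF _ sums_compl[of b]] one_mult by metis

lemma sums_split_right:
  "a \<in> carrier M \<Longrightarrow> b \<in> carrier M \<Longrightarrow> sums (a \<cdot> b) (a \<cdot> ecompl M b) a"
  using sums_mult_left[OF _ sums_compl[of b]] mult_one by metis

lemma mult_leq: "a \<in> carrier M \<Longrightarrow> b \<in> carrier M \<Longrightarrow> leq (a \<cdot> b) a"
  "a \<in> carrier M \<Longrightarrow> b \<in> carrier M \<Longrightarrow> leq (a \<cdot> b) b"
  using sums_split_left sums_split_right sums_leq by blast+

lemma mult_mono: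
  assumes "leq a a'" "leq b b'"
  shows "leq (a \<cdot> b) (a' \<cdot> b')"
proof -
  have "leq (a \<cdot> b) (a' \<cdot> b)"
    using assms leqD sums_mult_right by (metis leq_def)
  moreover have "leq (a' \<cdot> b) (a' \<cdot> b')"
    using assms leqD sums_mult_left by (metis leq_def)
  ultimately show ?thesis
    by (rule leq_trans)
qed

lemma mult_zero: "a \<in> carrier M \<Longrightarrow> a \<cdot> ezero M = ezero M"
  using mult_leq(2) leq_zero zero_closed by blast

primrec mpow :: "'a \<Rightarrow> nat \<Rightarrow> 'a" where
  "mpow a 0 = eone M"
| "mpow a (Suc n) = mpow a n \<cdot> a"

lemma mpow_closed: "a \<in> carrier M \<Longrightarrow> mpow a n \<in> carrier M"
  by (induction n) (auto simp: one_closed mult_closed)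

lemma mpow_decreasing: "a \<in> carrier M \<Longrightarrow> leq (mpow a (Suc n)) (mpow a n)"
  using mpow_closed mult_leq by simp

text \<open>With \<open>q = 1 - b\<close>, the complement form of
  \<open>q^n = q^(n+1) + q^n b\<close>: the terms \<open>q^n b\<close> are the increments of the
  sequence \<open>1 - q^n\<close>.\<close>

lemma sums_compl_mpow:
  assumes "b \<in> carrier M"
  shows "sums (ecompl M (mpow (ecompl M b) n)) (mpow (ecompl M b) n \<cdot> b)
    (ecompl M (mpow (ecompl M b) (Suc n)))"
  using sums_shift_compl[OF sums_commute[OF sums_split_right[OF mpow_closed[OF compl_closed] _]]]
    assms by simp

text \<open>Both products are what remains of \<open>b\<close> after subtracting
  \<open>b \<cdot> b\<close>.\<close>

lemma compl_mult_commute: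
  assumes "b \<in> carrier M"
  shows "b \<cdot> ecompl M b = ecompl M b \<cdot> b"
  using sums_split_left[OF assms assms] sums_split_right[OF assms assms] sums_cancel by blast

lemma compl_mpow_commute:
  assumes "b \<in> carrier M"
  shows "b \<cdot> mpow (ecompl M b) n = mpow (ecompl M b) n \<cdot> b"
proof (induction n)
  case 0
  then show ?case
    using assms by (simp add: mult_one one_mult)
next
  case (Suc n)
  let ?q = "ecompl M b" and ?p = "mpow (ecompl M b) n"
  have q: "?q \<in> carrier M" and p: "?p \<in> carrier M"
    using assms compl_closed mpow_closed by auto
  have "b \<cdot> (?p \<cdot> ?q) = ?p \<cdot> b \<cdot> ?q"
    using mult_assoc[OF assms p q] Suc by simp
  also have "\<dots> = ?p \<cdot> ?q \<cdot> b"
    using mult_assoc p q assms compl_mult_commute by simp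
  finally show ?case
    by simp
qed

lemma effect_monoid_opposite: "effect_monoid (M\<lparr>emult := \<lambda>x y. y \<cdot> x\<rparr>)"
proof -
  let ?M = "M\<lparr>emult := \<lambda>x y. y \<cdot> x\<rparr>"
  have one: "eone ?M = eone M"
    by (simp add: eone_def)
  have "effect_algebra ?M = effect_algebra M"
    by (simp add: effect_algebra_def one)
  then have "effect_algebra ?M"
    using effect_algebra_axioms by iprover
  moreover have "effect_monoid_axioms ?M"
    by (simp add: effect_monoid_axioms_def one mult_closed mult_assoc one_mult mult_one
        mult_psum_distrib psum_mult_distrib)
  ultimately show ?thesis
    by (rule effect_monoid.intro)
qed

end

section \<open>Archimedean consequences of omega-completeness\<close>

context omega_complete_effect_monoid
begin

lemma omega_complete_opposite: "omega_complete_effect_monoid (M\<lparr>emult := \<lambda>x y. y \<cdot> x\<rparr>)"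
proof -
  have "eorder (M\<lparr>emult := \<lambda>x y. y \<cdot> x\<rparr>) = eorder M"
    by (simp add: eorder_def)
  then show ?thesis
    using effect_monoid_opposite omega_complete
    by (auto simp: omega_complete_effect_monoid_def omega_complete_effect_monoid_axioms_def)
qed

lemma increasing_lub:
  assumes "\<And>n::nat. leq (C n) (C (Suc n))"
  obtains c where "c \<in> carrier M" "\<And>n. leq (C n) c" "\<And>u. (\<And>n. leq (C n) u) \<Longrightarrow> leq c u"
proof -
  have C: "C n \<in> carrier M" for n
    using leqD(1)[OF assms] .
  obtain c where "is_lub (eorder M) c (range C)"
    using omega_complete[of C, OF C] assms le_eorder[OF C] by auto
  moreover have "range C \<subseteq> carrier M"
    using C by blast
  ultimately have "c \<in> carrier M" "\<And>n. leq (C n) c"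
    "\<And>u. u \<in> carrier M \<Longrightarrow> (\<And>n. leq (C n) u) \<Longrightarrow> leq c u"
    by (auto simp: is_lub_iff)
  then show ?thesis
    using that[of c] leqD(2) by meson
qed

text \<open>Let \<open>c\<close> be the supremum of \<open>C\<close> and \<open>c = x + y\<close>.
  Since \<open>x + C n \<le> C (n+1) \<le> c\<close>, also \<open>y\<close> bounds every
  \<open>C n\<close>; hence \<open>y = c\<close> and \<open>x = 0\<close>.\<close>

lemma archimedean:
  assumes "\<And>n::nat. sums (C n) (z n) (C (Suc n))" and "\<And>n. leq x (z n)"
  shows "x = ezero M"
proof -
  obtain c where c: "c \<in> carrier M" "\<And>n. leq (C n) c" "\<And>u. (\<And>n. leq (C n) u) \<Longrightarrow> leq c u"
    using increasing_lub[of C, OF sums_leq(1)[OF assms(1)]] by blast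
  have "leq x c"
    using leq_trans[OF assms(2)[of 0] leq_trans[OF sums_leq(2)[OF assms(1)] c(2)]] .
  then obtain y where y: "sums x y c"
    by (auto simp: leq_def)
  have "leq (C n) y" for n
  proof -
    obtain d where d: "sums x (C n) d" "leq d (C (Suc n))"
      using sums_mono_left[OF assms(2) sums_commute[OF assms(1)]] by blast
    show ?thesis
      using leq_cancel[OF d(1) y leq_trans[OF d(2) c(2)]] .
  qed
  then have "y = c"
    using c(3) sums_leq(2)[OF y] leq_antisym by blast
  then show ?thesis
    using sums_cancel sums_commute y sums_zero[OF c(1)] by metis
qed

text \<open>Since \<open>r\<close> decreases, \<open>y\<close> increases to a supremum
  \<open>w \<le> c\<close>. The difference of \<open>u\<close> and \<open>w\<close> lies below every
  \<open>r n\<close>, so it is zero.\<close>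

lemma leq_if_vanishing_difference:
  assumes y: "\<And>n::nat. sums (y n) (r n) u" "\<And>n. leq (y n) c"
    and r: "\<And>n. leq (r (Suc n)) (r n)" "\<And>x. (\<And>n. leq x (r n)) \<Longrightarrow> x = ezero M"
  shows "leq u c"
proof -
  have "leq (y n) (y (Suc n))" for n
    using leq_diff[OF sums_commute[OF y(1)] sums_commute[OF y(1)] r(1)] .
  then obtain w where w: "w \<in> carrier M" "\<And>n. leq (y n) w" "\<And>v. (\<And>n. leq (y n) v) \<Longrightarrow> leq w v"
    using increasing_lub by blast
  then obtain x where x: "sums w x u"
    using w(3)[OF sums_leq(1)[OF y(1)]] by (auto simp: leq_def)
  have "leq x (r n)" for n
    using leq_diff[OF y(1) x w(2)] .
  then have "u = w"
    using r(2) x sums_zero[OF w(1)] sums_unique by blast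
  then show ?thesis
    using w(3) y(2) by blast
qed

text \<open>Dual to the previous lemma: \<open>c + r n = e n\<close> becomes
  \<open>(1 - e n) + r n = 1 - c\<close>.\<close>

lemma leq_if_vanishing_excess:
  assumes e: "\<And>n::nat. sums c (r n) (e n)" "\<And>n. leq d (e n)"
    and r: "\<And>n. leq (r (Suc n)) (r n)" "\<And>x. (\<And>n. leq x (r n)) \<Longrightarrow> x = ezero M"
  shows "leq d c"
proof -
  have "leq (ecompl M c) (ecompl M d)"
    by (rule leq_if_vanishing_difference[where r = r, OF sums_shift_compl[OF e(1)]
          compl_antimono[OF e(2)] r])
  then show ?thesis
    using compl_antimono compl_compl leqD(1)[OF e(2)] sumsD(1)[OF e(1)] by metis
qed

text \<open>The partial sums of the series with terms \<open>(1 - b)\<^sup>n \<cdot> b\<close> are \<open>1 - (1 - b)\<^sup>n\<close>.\<close>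

lemma mpow_compl_mult_vanishes:
  assumes "b \<in> carrier M" and "\<And>n. leq x (mpow (ecompl M b) n \<cdot> b)"
  shows "x = ezero M"
  using archimedean[where C = "\<lambda>n. ecompl M (mpow (ecompl M b) n)",
      OF sums_compl_mpow[OF assms(1)] assms(2)] .

lemma mpow_compl_mult_decreasing:
  assumes "b \<in> carrier M" "u \<in> carrier M"
  shows "leq (mpow (ecompl M b) (Suc n) \<cdot> u) (mpow (ecompl M b) n \<cdot> u)"
  using mult_mono mpow_decreasing compl_closed leq_refl assms by blast

section \<open>Approximate left division by \<open>b\<close>\<close>

lemma approximate_quotient:
  assumes b: "b \<in> carrier M" and u: "leq u b"
  obtains x where "sums (b \<cdot> x) (mpow (ecompl M b) n \<cdot> u) u"
    "\<And>s. s \<in> carrier M \<Longrightarrow> leq u (b \<cdot> s) \<Longrightarrow> leq x s"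
proof -
  let ?q = "\<lambda>n. mpow (ecompl M b) n"
  have q: "?q n \<in> carrier M" "ecompl M (?q n) \<in> carrier M" for n
    using b compl_closed mpow_closed by auto
  have uc: "u \<in> carrier M"
    using u leqD by blast
  \<comment> \<open>The induction needs more than \<open>x \<le> s\<close>: the factor
    \<open>1 - q^n\<close> leaves room for the next term \<open>q^n u\<close>, which is at most
    \<open>q^n b s\<close>.\<close>
  have "\<exists>x. sums (b \<cdot> x) (?q n \<cdot> u) u \<and>
    (\<forall>s\<in>carrier M. leq u (b \<cdot> s) \<longrightarrow> leq x (ecompl M (?q n) \<cdot> s))"
  proof (induction n)
    case 0
    have "sums (b \<cdot> ezero M) (?q 0 \<cdot> u) u"
      using b uc mult_zero one_mult sums_zero sums_commute by simp
    then show ?case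
      using zero_leq mult_closed one_closed compl_closed by auto
  next
    case (Suc n)
    then obtain x where x: "sums (b \<cdot> x) (?q n \<cdot> u) u"
      and xs: "\<And>s. s \<in> carrier M \<Longrightarrow> leq u (b \<cdot> s) \<Longrightarrow> leq x (ecompl M (?q n) \<cdot> s)"
      by blast
    have step: "\<exists>x'. sums x (?q n \<cdot> u) x' \<and> leq x' (ecompl M (?q (Suc n)) \<cdot> s)"
      if s: "s \<in> carrier M" "leq u (b \<cdot> s)" for s
    proof -
      have "leq (?q n \<cdot> u) (?q n \<cdot> b \<cdot> s)"
        using mult_mono[OF leq_refl s(2)] mult_assoc q b s by simp
      then show ?thesis
        using sums_mono[OF xs[OF s] _ sums_mult_right[OF s(1) sums_compl_mpow[OF b]]] by metis
    qed
    \<comment> \<open>The choice \<open>s = 1\<close> is admissible because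
      \<open>u \<le> b\<close>; it shows that the new partial sum is defined.\<close>
    obtain x' where x': "sums x (?q n \<cdot> u) x'"
      using step[OF one_closed] u mult_one b by auto
    obtain d where d: "sums (?q n \<cdot> (b \<cdot> u)) (?q (Suc n) \<cdot> u) (?q n \<cdot> u)"
      using sums_mult_left[OF q(1) sums_split_left[OF uc b]] mult_assoc q b uc compl_closed by simp
    obtain f where f: "sums (b \<cdot> x) (?q n \<cdot> (b \<cdot> u)) f" "sums f (?q (Suc n) \<cdot> u) u"
      using sums_assoc'[OF d x] by blast
    \<comment> \<open>Powers of \<open>1 - b\<close> commute with \<open>b\<close>, so the part
      split off the remainder is \<open>b\<close> times the new term.\<close>
    have "?q n \<cdot> (b \<cdot> u) = b \<cdot> (?q n \<cdot> u)"
      using mult_assoc q b uc compl_mpow_commute by metis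
    then have "f = b \<cdot> x'"
      using f(1) sums_mult_left[OF b x'] sums_unique by metis
    then show ?case
      using f(2) step x' sums_unique by metis
  qed
  then obtain x where x: "sums (b \<cdot> x) (?q n \<cdot> u) u"
    "\<And>s. s \<in> carrier M \<Longrightarrow> leq u (b \<cdot> s) \<Longrightarrow> leq x (ecompl M (?q n) \<cdot> s)"
    by blast
  then show ?thesis
    using that leq_trans[OF _ mult_leq(2)[OF q(2)]] by blast
qed

lemma mult_left_lower_bound:
  assumes b: "b \<in> carrier M" and u: "leq u b"
    and S: "S \<subseteq> carrier M" "\<And>s. s \<in> S \<Longrightarrow> leq u (b \<cdot> s)"
    and m: "is_glb (eorder M) m S"
  shows "leq u (b \<cdot> m)"
proof -
  let ?r = "\<lambda>n. mpow (ecompl M b) n \<cdot> u"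
  have uc: "u \<in> carrier M"
    using u leqD by blast
  have "\<exists>y. sums y (?r n) u \<and> leq y (b \<cdot> m)" for n
  proof -
    obtain x where x: "sums (b \<cdot> x) (?r n) u"
      "\<And>s. s \<in> carrier M \<Longrightarrow> leq u (b \<cdot> s) \<Longrightarrow> leq x s"
      using approximate_quotient[OF b u] by blast
    \<comment> \<open>The case \<open>s = 1\<close> gives \<open>x \<le> 1\<close>, hence carrier
      membership of \<open>x\<close>.\<close>
    have "leq u (b \<cdot> eone M)"
      using b u mult_one by simp
    then have "x \<in> carrier M"
      using x(2) one_closed leqD by blast
    then have "leq x m"
      using m is_glb_iff[OF S(1)] x(2) S by (meson subsetD)
    then show ?thesis
      using x(1) mult_mono leq_refl b by blast
  qed
  then obtain y where y: "\<And>n. sums (y n) (?r n) u" "\<And>n. leq (y n) (b \<cdot> m)"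
    by metis
  \<comment> \<open>As \<open>u \<le> b\<close>, the remainders are dominated by a sequence already
    known to vanish.\<close>
  have le: "leq (?r n) (mpow (ecompl M b) n \<cdot> b)" for n
    using mult_mono[OF leq_refl u] mpow_closed compl_closed b by blast
  have "x = ezero M" if "\<And>n. leq x (?r n)" for x
    by (rule mpow_compl_mult_vanishes[OF b leq_trans[OF that le]])
  then show ?thesis
    using leq_if_vanishing_difference[of y ?r, OF y] mpow_compl_mult_decreasing[OF b uc] by blast
qed

section \<open>Existence of binary meets\<close>

text \<open>Splitting \<open>d\<close> along \<open>(1 - a')\<^sup>n\<close>, a multiplier which fixes \<open>b'\<close> and sends \<open>a'\<close> to zero in the
  limit, bounds \<open>d\<close> by \<open>c + (1 - a')\<^sup>n \<cdot> a'\<close>.\<close>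

lemma orthogonal_remainders_meet:
  assumes a: "sums c a' a" and b: "sums c b' b" and ab: "a' \<cdot> b' = ezero M"
    and d: "leq d a" "leq d b"
  shows "leq d c"
proof -
  let ?q = "\<lambda>n. mpow (ecompl M a') n"
  note cl = sumsD[OF a] sumsD[OF b]
  have dc: "d \<in> carrier M"
    using d leqD by blast
  have q: "?q n \<in> carrier M" "ecompl M (?q n) \<in> carrier M" for n
    using cl compl_closed mpow_closed by auto
  \<comment> \<open>In \<open>b' = a' b' + (1 - a') b'\<close> the first summand is zero.\<close>
  have absorb: "ecompl M a' \<cdot> b' = b'"
    using sums_split_left[OF cl(5,2)] ab sums_commute sums_zero[OF cl(5)]
      sums_cancel sums_unique sumsD by metis
  have qb: "?q n \<cdot> b' = b'" for n
    using absorb by (induction n) (auto simp: one_mult mult_assoc q cl compl_closed)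
  have qb': "ecompl M (?q n) \<cdot> b' = ezero M" for n
    using sums_split_left[OF cl(5) q(1)[of n]] qb[of n] sums_zero[OF cl(5)] sums_cancel by metis
  have "\<exists>e. sums c (?q n \<cdot> a') e \<and> leq d e" for n
  proof -
    let ?p = "ecompl M (?q n)"
    have pb: "?p \<cdot> b = ?p \<cdot> c"
      using sums_mult_left[OF q(2)[of n] b] qb'[of n] sums_zero sums_unique mult_closed q(2) cl
      by metis
    \<comment> \<open>The sum \<open>q + p = 1\<close> dominates \<open>q a + p b\<close> termwise,
      so the latter is defined.\<close>
    have "sums (?q n \<cdot> eone M) (?p \<cdot> eone M) (eone M)"
      using sums_split_left[OF one_closed q(1)] .
    then obtain e where e: "sums (?q n \<cdot> a) (?p \<cdot> b) e"
      using sums_mono[OF mult_mono[OF leq_refl leq_one] mult_mono[OF leq_refl leq_one]] q cl by metis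
    obtain f where f: "sums (?q n \<cdot> c) (?p \<cdot> b) f" "sums (?q n \<cdot> a') f e"
      using sums_assoc[OF sums_commute[OF sums_mult_left[OF q(1) a]] e] by metis
    \<comment> \<open>Here \<open>p b = p c\<close>, and \<open>q c + p c = c\<close>; thus
      \<open>e = c + q a'\<close>.\<close>
    have "f = c"
      using f(1) pb sums_split_left[OF cl(1) q(1)] sums_unique by metis
    \<comment> \<open>Compare \<open>d = q d + p d\<close> termwise with
      \<open>q a + p b\<close>.\<close>
    moreover have "leq d e"
      using sums_mono[OF mult_mono[OF leq_refl d(1)] mult_mono[OF leq_refl d(2)] e]
        sums_split_left[OF dc q(1)] sums_unique q by metis
    ultimately show ?thesis
      using f(2) sums_commute by blast
  qed
  then obtain e where "\<And>n. sums c (?q n \<cdot> a') (e n)" "\<And>n. leq d (e n)"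
    by metis
  then show ?thesis
    using leq_if_vanishing_excess[of c "\<lambda>n. ?q n \<cdot> a'" e d]
      mpow_compl_mult_decreasing mpow_compl_mult_vanishes cl by blast
qed

text \<open>Repeatedly remove the common part \<open>x \<cdot> y\<close> from both elements; the total amount removed is
  the meet.\<close>

lemma meet_exists:
  assumes a: "a \<in> carrier M" and b: "b \<in> carrier M"
  obtains c where "leq c a" "leq c b" "\<And>d. leq d a \<Longrightarrow> leq d b \<Longrightarrow> leq d c"
proof -
  \<comment> \<open>Subtracting \<open>x y\<close> leaves \<open>x (1 - y)\<close> and
    \<open>(1 - x) y\<close>; both components are updated from the old pair.\<close>
  define f where "f n = ((\<lambda>(x, y). (x \<cdot> ecompl M y, ecompl M x \<cdot> y)) ^^ n) (a, b)" for n :: nat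
  define x y where "x n = fst (f n)" and "y n = snd (f n)" for n
  have x0: "x 0 = a" "y 0 = b"
    by (simp_all add: x_def y_def f_def)
  have Suc: "x (Suc n) = x n \<cdot> ecompl M (y n)" "y (Suc n) = ecompl M (x n) \<cdot> y n" for n
    by (simp_all add: x_def y_def f_def case_prod_beta)
  have cl: "x n \<in> carrier M \<and> y n \<in> carrier M" for n
    by (induction n) (auto simp: x0 Suc a b mult_closed compl_closed)
  have x: "sums (x n \<cdot> y n) (x (Suc n)) (x n)" for n
    using sums_split_right cl Suc by simp
  have y: "sums (x n \<cdot> y n) (y (Suc n)) (y n)" for n
    using sums_split_left cl Suc by simp
  \<comment> \<open>The same total \<open>C\<close> has been removed from both elements.\<close>
  have "\<exists>C. sums C (x n) a \<and> sums C (y n) b" for n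
  proof (induction n)
    case 0
    then show ?case
      using x0 sums_zero sums_commute a b by metis
  next
    case (Suc n)
    then obtain C where C: "sums C (x n) a" "sums C (y n) b"
      by blast
    show ?case
      using sums_assoc'[OF x C(1)] sums_assoc'[OF y C(2)] sums_unique by metis
  qed
  then obtain C where C: "\<And>n. sums (C n) (x n) a" "\<And>n. sums (C n) (y n) b"
    by metis
  have step: "sums (C n) (x n \<cdot> y n) (C (Suc n))" for n
    using sums_assoc'[OF x C(1)] C(1)[of "Suc n"] sums_cancel sums_commute by metis
  obtain c where c: "c \<in> carrier M" "\<And>n. leq (C n) c" "\<And>u. (\<And>n. leq (C n) u) \<Longrightarrow> leq c u"
    using increasing_lub[of C, OF sums_leq(1)[OF step]] by blast
  have ca: "leq c a" and cb: "leq c b"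
    using c(3) sums_leq(1)[OF C(1)] sums_leq(1)[OF C(2)] by auto
  then obtain a' b' where a': "sums c a' a" and b': "sums c b' b"
    by (auto simp: leq_def)
  \<comment> \<open>Consequently \<open>a' b'\<close> lies below every increment
    \<open>x n \<cdot> y n\<close> of \<open>C\<close>.\<close>
  have "leq a' (x n)" "leq b' (y n)" for n
    using leq_diff[OF C(1) a' c(2)] leq_diff[OF C(2) b' c(2)] by auto
  then have "a' \<cdot> b' = ezero M"
    using archimedean[of C, OF step] mult_mono by blast
  then show ?thesis
    using that ca cb orthogonal_remainders_meet[OF a' b'] by blast
qed

section \<open>Suprema and infima of multiples\<close>

lemma is_glb_compl:
  assumes S: "S \<subseteq> carrier M" and m: "is_lub (eorder M) m S"
  shows "is_glb (eorder M) (ecompl M m) (ecompl M ` S)"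
proof -
  have mS: "m \<in> carrier M" "\<And>s. s \<in> S \<Longrightarrow> leq s m"
    "\<And>u. u \<in> carrier M \<Longrightarrow> (\<And>s. s \<in> S \<Longrightarrow> leq s u) \<Longrightarrow> leq m u"
    using m is_lub_iff[OF S] by auto
  have "leq u (ecompl M m)" if u: "u \<in> carrier M" "\<And>s. s \<in> S \<Longrightarrow> leq u (ecompl M s)" for u
  proof -
    have "leq s (ecompl M u)" if "s \<in> S" for s
      using compl_antimono[OF u(2)[OF that]] compl_compl S that by auto
    then show ?thesis
      using compl_antimono[OF mS(3)] compl_closed compl_compl u(1) by metis
  qed
  then show ?thesis
    using S mS(1,2) compl_closed compl_antimono
    by (subst is_glb_iff) (auto simp: image_subset_iff subset_iff)
qed

lemma is_glb_mult_left:
  assumes b: "b \<in> carrier M" and S: "S \<subseteq> carrier M" "S \<noteq> {}" and m: "is_glb (eorder M) m S"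
  shows "is_glb (eorder M) (b \<cdot> m) ((\<lambda>s. b \<cdot> s) ` S)"
proof -
  have mS: "m \<in> carrier M" "\<And>s. s \<in> S \<Longrightarrow> leq m s"
    using m is_glb_iff[OF S(1)] by auto
  have cl: "(\<lambda>s. b \<cdot> s) ` S \<subseteq> carrier M"
    using S b mult_closed by auto
  have "leq u (b \<cdot> m)" if u: "\<And>s. s \<in> S \<Longrightarrow> leq u (b \<cdot> s)" for u
  proof -
    \<comment> \<open>Any element of \<open>S\<close> puts \<open>u\<close> below \<open>b\<close>,
      as \<open>mult_left_lower_bound\<close> requires.\<close>
    obtain s where "s \<in> S"
      using S by blast
    then have "leq u b"
      using leq_trans[OF u mult_leq(1)] b S by blast
    then show ?thesis
      using mult_left_lower_bound b S(1) u m by blast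
  qed
  then show ?thesis
    using mS b mult_closed mult_mono leq_refl by (auto simp: is_glb_iff[OF cl])
qed

lemma is_lub_mult_left:
  assumes b: "b \<in> carrier M" and S: "S \<subseteq> carrier M" and m: "is_lub (eorder M) m S"
  shows "is_lub (eorder M) (b \<cdot> m) ((\<lambda>s. b \<cdot> s) ` S)"
proof -
  have mS: "m \<in> carrier M" "\<And>s. s \<in> S \<Longrightarrow> leq s m"
    using m is_lub_iff[OF S(1)] by auto
  have cl: "(\<lambda>s. b \<cdot> s) ` S \<subseteq> carrier M"
    using S b mult_closed by auto
  have "leq (b \<cdot> m) u" if uc: "u \<in> carrier M" and u: "\<And>s. s \<in> S \<Longrightarrow> leq (b \<cdot> s) u" for u
  proof -
    \<comment> \<open>Every \<open>b s\<close> lies below \<open>b\<close>, so the meet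
      \<open>w\<close> is still an upper bound, and now it can be subtracted from
      \<open>b\<close>.\<close>
    obtain w where w: "leq w u" "leq w b" "\<And>d. leq d u \<Longrightarrow> leq d b \<Longrightarrow> leq d w"
      using meet_exists[OF uc b] by blast
    obtain v where v: "sums w v b"
      using w(2) by (auto simp: leq_def)
    \<comment> \<open>Subtracting \<open>b s \<le> w\<close> from \<open>b\<close> reverses the
      order, and \<open>b - b s = b (1 - s)\<close>.\<close>
    have "leq v (b \<cdot> ecompl M s)" if "s \<in> S" for s
    proof -
      have s: "s \<in> carrier M"
        using that S by blast
      then show ?thesis
        using leq_diff[OF sums_split_right[OF b s] v] w(3) u[OF that] mult_leq(1)[OF b s] by blast
    qed
    then have "leq v (b \<cdot> ecompl M m)"
      using mult_left_lower_bound[OF b sums_leq(2)[OF v] _ _ is_glb_compl[OF S m]]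
        S compl_closed by blast
    \<comment> \<open>Subtracting \<open>v \<le> b (1 - m)\<close> from \<open>b\<close> reverses
      the order back.\<close>
    then have "leq (b \<cdot> m) w"
      using leq_diff sums_commute v sums_split_right[OF b mS(1)] by metis
    then show ?thesis
      using leq_trans[OF _ w(1)] by blast
  qed
  then show ?thesis
    using mS b mult_closed mult_mono leq_refl by (auto simp: is_lub_iff[OF cl])
qed

lemma
  assumes b: "b \<in> carrier M" and S: "S \<subseteq> carrier M"
  shows is_lub_mult_right:
      "is_lub (eorder M) m S \<Longrightarrow> is_lub (eorder M) (m \<cdot> b) ((\<lambda>s. s \<cdot> b) ` S)"
    and is_glb_mult_right:
      "S \<noteq> {} \<Longrightarrow> is_glb (eorder M) m S \<Longrightarrow> is_glb (eorder M) (m \<cdot> b) ((\<lambda>s. s \<cdot> b) ` S)"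
proof -
  let ?M = "M\<lparr>emult := \<lambda>x y. y \<cdot> x\<rparr>"
  interpret op: omega_complete_effect_monoid ?M
    by (rule omega_complete_opposite)
  \<comment> \<open>The order ignores multiplication, so bounds in \<open>?M\<close> and in
    \<open>M\<close> agree.\<close>
  have "eorder ?M = eorder M"
    by (simp add: eorder_def)
  then show "is_lub (eorder M) m S \<Longrightarrow> is_lub (eorder M) (m \<cdot> b) ((\<lambda>s. s \<cdot> b) ` S)"
    and "S \<noteq> {} \<Longrightarrow> is_glb (eorder M) m S \<Longrightarrow> is_glb (eorder M) (m \<cdot> b) ((\<lambda>s. s \<cdot> b) ` S)"
    using op.is_lub_mult_left[of b S m] op.is_glb_mult_left[of b S m] b S by simp_all
qed

lemma
  assumes b: "b \<in> carrier M" "b' \<in> carrier M" and S: "S \<subseteq> carrier M"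
  shows is_lub_mult: "is_lub (eorder M) m S \<Longrightarrow>
      is_lub (eorder M) (b \<cdot> m \<cdot> b') ((\<lambda>s. b \<cdot> s \<cdot> b') ` S)"
    and is_glb_mult: "S \<noteq> {} \<Longrightarrow> is_glb (eorder M) m S \<Longrightarrow>
      is_glb (eorder M) (b \<cdot> m \<cdot> b') ((\<lambda>s. b \<cdot> s \<cdot> b') ` S)"
proof -
  have cl: "(\<lambda>s. b \<cdot> s) ` S \<subseteq> carrier M"
    using S b mult_closed by auto
  show "is_lub (eorder M) m S \<Longrightarrow> is_lub (eorder M) (b \<cdot> m \<cdot> b') ((\<lambda>s. b \<cdot> s \<cdot> b') ` S)"
    using is_lub_mult_right[OF b(2) cl is_lub_mult_left[OF b(1) S]] by (simp add: image_image)
  show "S \<noteq> {} \<Longrightarrow> is_glb (eorder M) m S \<Longrightarrow>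
      is_glb (eorder M) (b \<cdot> m \<cdot> b') ((\<lambda>s. b \<cdot> s \<cdot> b') ` S)"
    using is_glb_mult_right[OF b(2) cl _ is_glb_mult_left[OF b(1) S]] by (simp add: image_image)
qed

end

theorem theorem43:
  fixes M :: "('a, 'm) effect_monoid_scheme" (structure)
    and b b' :: 'a
    and S :: "'a set"
  assumes "omega_complete_effect_monoid M"
    and "b \<in> carrier M"
    and "b' \<in> carrier M"
    and "S \<subseteq> carrier M"
    and "S \<noteq> {}"
  shows "((\<exists>x. is_lub (eorder M) x S) \<longrightarrow>
          (\<exists>y. is_lub (eorder M) y ((\<lambda>s. b \<cdot> s \<cdot> b') ` S)) \<and>
          b \<cdot> (\<Squnion>\<^bsub>eorder M\<^esub> S) \<cdot> b' = (SSUP\<^bsub>eorder M\<^esub> s:S. b \<cdot> s \<cdot> b')) \<and>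
         ((\<exists>x. is_glb (eorder M) x S) \<longrightarrow>
          (\<exists>y. is_glb (eorder M) y ((\<lambda>s. b \<cdot> s \<cdot> b') ` S)) \<and>
          b \<cdot> (\<Sqinter>\<^bsub>eorder M\<^esub> S) \<cdot> b' = (IINF\<^bsub>eorder M\<^esub> s:S. b \<cdot> s \<cdot> b'))"
proof -
  interpret omega_complete_effect_monoid M
    by fact
  have cl: "(\<lambda>s. b \<cdot> s \<cdot> b') ` S \<subseteq> carrier M"
    using assms mult_closed by auto
  note lub = is_lub_mult[OF assms(2-4)] and glb = is_glb_mult[OF assms(2-5)]
  \<comment> \<open>Any witness of existence equals the chosen bound, so both sides reduce to
    \<open>b x b'\<close> for that witness \<open>x\<close>.\<close>
  show ?thesis
    using lub glb sup_eqI[OF _ assms(4)] inf_eqI[OF _ assms(4)]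
      sup_eqI[OF lub cl] inf_eqI[OF glb cl]
    by (auto simp: supr_def infi_def)
qed

end
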